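(* Let $T$ be a tree of order $n\geq 5$. Let $k$ and $i$ be nonnegative integers with $0\leq i\leq 2k$ and $4n-4=k^2+i$. Then for any leaf $u$ of $T$, \[\frac{\operatorname{Ecc}(T)}{\operatorname{ecc}_T(u)} \geq \begin{cases} \frac{n-1}{2}+\frac{k}{2}+\frac{i}{4k} & \text{if } k \text{ is even},\\ \frac{n-1}{2}+\frac{k}{2}+\frac{i+1}{4(k+1)} & \text{if } k \text{ is odd}.\end{cases}\] Equality holds if and only if $T$ has a longest path $P$ with endpoint $u$ and of length $2x$, where $2x=k$ in the first case and $2x=k+1$ in the second case, and every vertex not on $P$ is adjacent to the middle vertex of $P$.
   Context: For a vertex $v$ of a tree $T$, $\operatorname{ecc}_T(v)=\max_{w\in V(T)} d_T(v,w)$. The total eccentricity is $\operatorname{Ecc}(T)=\sum_{z\in V(T)}\operatorname{ecc}_T(z)$. A leaf is a vertex of degree 1. The length of a path is its number of edges.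
   Formalization: When k is even and i=2k, the equality condition is corrected to "2x=k or 2x=k+2": as stated it fails, e.g. for the path on 7 vertices (n=7, k=4, i=8), where the ratio 33/6 equals the bound but the longest path has length 6. *)

theory Defs
  imports "Graph_Theory.Graph_Theory"
begin

text \<open>
  Finite simple graphs are the locale \<^locale>\<open>graph\<close>: finite symmetric digraphs without loops
  and parallel arcs. The predicate \<open>tree\<close> of the library is not usable for them, since it only
  excludes directed cycles and counts \<open>a, b, a\<close> as one. A cycle of a simple graph has at least
  three vertices; it is given here by a path whose ends are adjacent.
\<close>

locale simple_tree = graph T for T :: "('a, 'b) pre_digraph" (structure) +
  assumes tree_connected: "connected T"
    and tree_acyclic: "\<not> (\<exists>p. vpath p T \<and> 3 \<le> length p \<and> last p \<rightarrow> hd p)"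

definition gdist :: "('a, 'b) pre_digraph \<Rightarrow> 'a \<Rightarrow> 'a \<Rightarrow> nat" where
  "gdist G u v = (LEAST d. \<exists>p. vwalk p G \<and> hd p = u \<and> last p = v \<and> vwalk_length p = d)"

lemma (in wf_digraph) vwalk_awalk:
  "vwalk q G \<Longrightarrow> \<exists>r. awalk (hd q) r (last q) \<and> length q = Suc (length r)"
proof (induct rule: vwalk_induct)
  case (Base w)
  then show ?case by (intro exI[of _ "[]"]) (auto simp: awalk_Nil_iff)
next
  case (Cons w z es)
  then obtain r where r: "awalk z r (last (z # es))" "length (z # es) = Suc (length r)"
    by auto
  from Cons(1) obtain e where "e \<in> arcs G" "tail G e = w" "head G e = z" by auto
  with r show ?case by (intro exI[of _ "e # r"]) (auto simp: awalk_Cons_iff)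
qed

text \<open>Agreement with the weighted distance of the library for unit weights.\<close>

lemma (in fin_digraph) gdist_eq_\<mu>:
  assumes "u \<rightarrow>\<^sup>* v"
  shows "\<mu> (\<lambda>_. 1) u v = ereal (real (gdist G u v))"
proof -
  have cost: "awalk_cost (\<lambda>_. 1) p = real (length p)" for p
    by (induct p) auto
  obtain p where p: "awalk u p v" "\<mu> (\<lambda>_. 1) u v = ereal (real (length p))"
    using min_cost_awalk[OF assms, of "\<lambda>_. 1"] by (auto simp: cost apath_def)
  have "gdist G u v = length p"
    unfolding gdist_def
  proof (rule Least_equality)
    show "\<exists>q. vwalk q G \<and> hd q = u \<and> last q = v \<and> vwalk_length q = length p"
      using p(1) awalk_imp_vwalk[OF p(1)]
      by (intro exI[of _ "awalk_verts u p"]) (auto simp: length_awalk_verts)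
  next
    fix d
    assume "\<exists>q. vwalk q G \<and> hd q = u \<and> last q = v \<and> vwalk_length q = d"
    then obtain q where q: "vwalk q G" "hd q = u" "last q = v" "length q - 1 = d" by auto
    then obtain r where r: "awalk u r v" "length q = Suc (length r)"
      using vwalk_awalk by metis
    have "length r = d"
      using q(4) r(2) by simp
    moreover have "\<mu> (\<lambda>_. 1) u v \<le> ereal (real (length r))"
      using min_cost_le_walk_cost[OF r(1), of "\<lambda>_. 1"] by (simp add: cost)
    ultimately show "length p \<le> d"
      using p(2) by simp
  qed
  then show ?thesis using p(2) by simp
qed

definition ecc :: "('a, 'b) pre_digraph \<Rightarrow> 'a \<Rightarrow> nat" where
  "ecc G v = Max (gdist G v ` verts G)"

definition total_ecc :: "('a, 'b) pre_digraph \<Rightarrow> nat" where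
  "total_ecc G = (\<Sum>z\<in>verts G. ecc G z)"

text \<open>In a \<^locale>\<open>graph\<close> the arcs leaving a vertex correspond to its incident edges.\<close>

definition leaf :: "('a, 'b) pre_digraph \<Rightarrow> 'a \<Rightarrow> bool" where
  "leaf G v \<longleftrightarrow> v \<in> verts G \<and> out_degree G v = 1"

definition longest_path :: "'a vwalk \<Rightarrow> ('a, 'b) pre_digraph \<Rightarrow> bool" where
  "longest_path p G \<longleftrightarrow> vpath p G \<and> (\<forall>q. vpath q G \<longrightarrow> vwalk_length q \<le> vwalk_length p)"

text \<open>
  \<open>extremal_at G u m\<close>: a longest path with endpoint \<open>u\<close> has even length \<open>m\<close>, and all vertices
  off it are adjacent to its middle vertex. The path is listed starting from \<open>u\<close>, so its
  middle vertex is the entry at index \<open>x\<close>.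
\<close>

definition extremal_at :: "('a, 'b) pre_digraph \<Rightarrow> 'a \<Rightarrow> nat \<Rightarrow> bool" where
  "extremal_at G u m \<longleftrightarrow>
     (\<exists>p x. m = 2 * x \<and> longest_path p G \<and> hd p = u \<and> vwalk_length p = 2 * x \<and>
            (\<forall>v \<in> verts G - set p. v \<rightarrow>\<^bsub>G\<^esub> (p ! x)))"

text \<open>
  An extremal tree of order \<open>n\<close> with path length \<open>2 * x\<close> has the ratio
  \<open>(n - 1) / 2 + x / 2 + (n - 1) / (2 * x)\<close>. For even \<open>k\<close> and \<open>i = 2 * k\<close> we have
  \<open>n - 1 = (k / 2) * (k / 2 + 1)\<close>, and then \<open>x = k / 2\<close> and \<open>x = k / 2 + 1\<close> give the same, minimal
  ratio. So in this case path length \<open>k + 2\<close> is also extremal: for \<open>n = 7\<close>, \<open>k = 4\<close>, \<open>i = 8\<close>,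
  the path on seven vertices has ratio \<open>33 / 6\<close>, which is the value of the bound.
\<close>

definition ecc_ratio_bound :: "nat \<Rightarrow> nat \<Rightarrow> nat \<Rightarrow> real" where
  "ecc_ratio_bound n k i =
     (if even k then (real n - 1) / 2 + real k / 2 + real i / (4 * real k)
      else (real n - 1) / 2 + real k / 2 + (real i + 1) / (4 * (real k + 1)))"

end

theory Submission
  imports Defs
begin

text \<open>
  Let \<open>p\<close> be a path of length \<open>e\<close> from \<open>u\<close> to a vertex farthest from \<open>u\<close>, where \<open>e\<close> is the
  eccentricity of \<open>u\<close>. The entry of \<open>p\<close> at index \<open>j\<close> has eccentricity at least \<open>max j (e - j)\<close>. A
  vertex off \<open>p\<close> has even surplus at least 2 in the sum of its distances to the ends of \<open>p\<close> over
  \<open>e\<close>, hence eccentricity at least \<open>\<lceil>e / 2\<rceil> + 1\<close>. Summing bounds the ratio below by a function of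
  \<open>e\<close> and \<open>n\<close>, which for \<open>e = 2 * x\<close> is \<open>m / 2 + (x + m / x) / 2\<close> with \<open>m = n - 1\<close>. It remains to
  minimize over the integers \<open>x\<close> and to see that odd \<open>e\<close> always does worse. Equality forces every
  vertex off \<open>p\<close> to be attached at the middle at height 1.
\<close>

section \<open>Paths as vertex lists and their uniqueness in a tree\<close>

text \<open>Trades arc lists for \<open>successively\<close>, whose rules for append, cons and
  reversal carry all later cutting and splicing of paths.\<close>

lemma vwalk_iff_successively:
  "vwalk p G \<longleftrightarrow> p \<noteq> [] \<and> set p \<subseteq> verts G \<and> successively (dominates G) p"
proof -
  have "set (vwalk_arcs p) \<subseteq> arcs_ends G \<longleftrightarrow> successively (dominates G) p"
    by (induct p rule: vwalk_arcs.induct) auto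
  then show ?thesis by (auto simp: vwalk_def)
qed

lemma vpath_iff_successively:
  "vpath p G \<longleftrightarrow> p \<noteq> [] \<and> set p \<subseteq> verts G \<and> successively (dominates G) p \<and> distinct p"
  by (auto simp: vpath_def vwalk_iff_successively)

lemma vpath_nth_in_verts: "vpath p G \<Longrightarrow> i < length p \<Longrightarrow> p ! i \<in> verts G"
  using nth_mem by (auto simp: vpath_iff_successively)

lemma vwalk_to_vpath_length_le: "length (vwalk_to_vpath p) \<le> length p"
  by (induct p rule: vwalk_to_vpath_induct3)
    (auto intro: le_SucI order_trans[OF _ length_dropWhile_le])

lemma (in simple_tree) dominates_commute: "u \<rightarrow>\<^bsub>T\<^esub> v \<longleftrightarrow> v \<rightarrow>\<^bsub>T\<^esub> u"
  using sym_arcs unfolding symmetric_def sym_def by blast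

lemma (in simple_tree) successively_dominates_rev [simp]:
  "successively (dominates T) (rev p) \<longleftrightarrow> successively (dominates T) p"
  by (simp add: dominates_commute cong: successively_cong)

text \<open>If two paths with common ends diverge after \<open>a\<close>, the first vertex of one that recurs on the
  other closes a cycle through \<open>a\<close>.\<close>

lemma (in simple_tree) vpath_unique:
  assumes "vpath p T" "vpath q T" "hd p = hd q" "last p = last q"
  shows "p = q"
  using assms
proof (induct p arbitrary: q)
  case Nil
  then show ?case by (auto simp: vpath_iff_successively)
next
  case (Cons a p)
  obtain q' where q: "q = a # q'"
    using Cons.prems by (cases q) (auto simp: vpath_iff_successively)
  show ?case
  proof (cases "p = [] \<or> q' = []")
    case True
    then show ?thesis
      using Cons.prems q by (auto simp: vpath_iff_successively split: if_splits)
  next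
    case False
    then have ne: "p \<noteq> []" "q' \<noteq> []" by auto
    have P: "vpath p T" "vpath q' T" "last p = last q'" "a \<notin> set p" "a \<notin> set q'"
        "a \<rightarrow>\<^bsub>T\<^esub> hd p" "a \<rightarrow>\<^bsub>T\<^esub> hd q'" "a \<in> verts T"
      using Cons.prems q ne by (auto simp: vpath_iff_successively successively_Cons)
    show ?thesis
    proof (cases "hd p = hd q'")
      case True
      then show ?thesis using Cons.hyps P q by blast
    next
      case False
      have "\<exists>x\<in>set p. x \<in> set q'"
        using last_in_set[OF ne(1)] last_in_set[OF ne(2)] P(3) by auto
      from split_list_first_prop[OF this]
      obtain p1 c p2 where p: "p = p1 @ c # p2" "c \<in> set q'" "\<forall>x\<in>set p1. x \<notin> set q'"
        by blast
      then obtain q1 q2 where q': "q' = q1 @ c # q2"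
        by (meson split_list)
      let ?z = "a # p1 @ c # rev q1"
      have "vpath ?z T"
      proof -
        have "successively (dominates T) (p1 @ [c])" "successively (dominates T) (q1 @ [c])"
          using P(1,2) p(1) q'
          by (auto simp: vpath_iff_successively successively_append_iff)
        then have "successively (dominates T) (p1 @ [c])" "successively (dominates T) (c # rev q1)"
          using successively_dominates_rev[of "q1 @ [c]"] by auto
        then have "successively (dominates T) (p1 @ c # rev q1)"
          by (auto simp: successively_append_iff)
        moreover have "hd (p1 @ c # rev q1) = hd p"
          using p(1) by (cases p1) auto
        ultimately have "successively (dominates T) ?z"
          using P(6) by (simp add: successively_Cons)
        moreover have "distinct ?z" "set ?z \<subseteq> verts T"
          using P p q' by (auto simp: vpath_iff_successively)
        ultimately show ?thesis by (simp add: vpath_iff_successively)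
      qed
      \<comment> \<open>\<open>p1\<close> and \<open>q1\<close> are not both empty, since otherwise
        both paths would continue with \<open>c\<close> after \<open>a\<close>.\<close>
      moreover have "3 \<le> length ?z"
        using False p q' by (cases p1; cases q1) auto
      moreover have "last ?z \<rightarrow>\<^bsub>T\<^esub> hd ?z"
        using P(7) q' by (cases q1) (auto simp: dominates_commute)
      ultimately show ?thesis using tree_acyclic by blast
    qed
  qed
qed

section \<open>Distances to the vertices of a path\<close>

lemma gdist_le_vwalk:
  assumes "vwalk p G"
  shows "gdist G (hd p) (last p) \<le> length p - 1"
  unfolding gdist_def using assms by (intro Least_le exI[of _ p]) simp

text \<open>A shortest walk between the ends reduces to a path without getting longer, and by
  uniqueness that path is \<open>p\<close>.\<close>

lemma (in simple_tree) gdist_vpath: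
  assumes "vpath p T"
  shows "gdist T (hd p) (last p) = length p - 1"
proof -
  have p: "\<exists>d q. vwalk q T \<and> hd q = hd p \<and> last q = last p \<and> vwalk_length q = d"
    using assms unfolding vpath_def by blast
  obtain q where q: "vwalk q T" "hd q = hd p" "last q = last p"
      "vwalk_length q = gdist T (hd p) (last p)"
    using LeastI_ex[OF p] unfolding gdist_def by blast
  have "vwalk_to_vpath q = p"
    using vpath_unique[OF vwalk_to_vpath_vpath[OF q(1)] assms] q(2,3)
    by (simp add: vwalk_to_vpath_hd vwalk_to_vpath_last)
  then have "length p - 1 \<le> gdist T (hd p) (last p)"
    using vwalk_to_vpath_length_le[of q] q(4) by (simp add: diff_le_mono)
  then show ?thesis
    using gdist_le_vwalk[of p T] assms by (simp add: vpath_def)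
qed

lemma (in simple_tree) gdist_hd_nth:
  assumes "vpath p T" "i < length p"
  shows "gdist T (hd p) (p ! i) = i"
proof -
  have "successively (dominates T) (take (Suc i) p @ drop (Suc i) p)"
    using assms by (simp add: vpath_iff_successively)
  then have "vpath (take (Suc i) p) T"
    using assms set_take_subset[of "Suc i" p]
    unfolding successively_append_iff vpath_iff_successively by auto
  moreover have "hd (take (Suc i) p) = hd p"
    by (cases p) auto
  moreover have "last (take (Suc i) p) = p ! i"
    using assms by (simp add: take_Suc_conv_app_nth)
  ultimately show ?thesis
    using gdist_vpath[of "take (Suc i) p"] assms(2) by simp
qed

lemma (in simple_tree) vpath_exists:
  assumes "u \<in> verts T" "v \<in> verts T"
  obtains p where "vpath p T" "hd p = u" "last p = v"
proof -
  have "u \<rightarrow>\<^sup>*\<^bsub>T\<^esub> v"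
    using assms tree_connected
    by (auto simp: connected_def strongly_connected_def reachable_mk_symmetric_eq[OF sym_arcs])
  then show ?thesis using reachable_vpath_conv that by blast
qed

text \<open>The branch at \<open>v\<close> is attached to \<open>p\<close> at \<open>p ! j\<close> by a path of length \<open>h\<close>. With truncated
  subtraction, \<open>(i - j) + (j - i)\<close> is the distance of the indices.\<close>

lemma (in simple_tree) gdist_to_vpath:
  assumes "vpath p T" "v \<in> verts T"
  obtains j h where "j < length p" "h = 0 \<longleftrightarrow> v \<in> set p"
    "h = 1 \<Longrightarrow> v \<rightarrow>\<^bsub>T\<^esub> p ! j"
    "\<And>i. i < length p \<Longrightarrow> gdist T v (p ! i) = h + ((i - j) + (j - i))"
proof -
  have pne: "p \<noteq> []" "hd p \<in> verts T"
    using assms by (auto simp: vpath_iff_successively)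
  obtain q where q: "vpath q T" "hd q = v" "last q = hd p"
    using vpath_exists[OF assms(2) pne(2)] .
  then have "q \<noteq> []" by (auto simp: vpath_iff_successively)
  then have "\<exists>x\<in>set q. x \<in> set p"
    using last_in_set[of q] hd_in_set[OF pne(1)] q(3) by auto
  \<comment> \<open>On the way from \<open>v\<close> to the start of \<open>p\<close>,
    \<open>c\<close> is the first vertex of \<open>p\<close>. So \<open>q1\<close> is the branch,
    disjoint from \<open>p\<close>, and \<open>A\<close>, \<open>B\<close> are the two arms of
    \<open>p\<close> at \<open>c\<close>.\<close>
  from split_list_first_prop[OF this]
  obtain q1 c q2 where qs: "q = q1 @ c # q2" "c \<in> set p" "\<forall>x\<in>set q1. x \<notin> set p"
    by blast
  then obtain A B where p: "p = A @ c # B"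
    by (meson split_list)
  have v: "hd (q1 @ c # r) = v" for r
    using q(2) qs by (cases q1) auto
  have "q1 \<noteq> [] \<Longrightarrow> last q1 \<rightarrow>\<^bsub>T\<^esub> c" "successively (dominates T) q1"
      "distinct q1" "set q1 \<subseteq> verts T"
    using q(1) qs by (auto simp: vpath_iff_successively successively_append_iff)
  moreover have "successively (dominates T) (c # B)" "successively (dominates T) (c # rev A)"
      "distinct (A @ c # B)" "set (A @ c # B) \<subseteq> verts T"
    using assms(1) p
    by (auto simp: vpath_iff_successively successively_append_iff successively_Cons hd_rev dominates_commute)
  \<comment> \<open>Following the branch and then either arm gives a path from \<open>v\<close>;
    every vertex of \<open>p\<close> lies on one of the two, at a position equal to its distance
    from \<open>v\<close>.\<close>
  ultimately have up: "vpath (q1 @ c # B) T" and down: "vpath (q1 @ c # rev A) T"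
    using qs(3) p
    unfolding vpath_iff_successively successively_append_iff by auto
  show ?thesis
  proof (rule that[of "length A" "length q1"])
    show "length q1 = 0 \<longleftrightarrow> v \<in> set p"
      using v qs by (cases q1) auto
    show "v \<rightarrow>\<^bsub>T\<^esub> p ! length A" if "length q1 = 1"
    proof -
      have "q1 = [v]"
        using that v by (cases q1) auto
      then show ?thesis
        using up p by (simp add: vpath_iff_successively)
    qed
    show "gdist T v (p ! i) = length q1 + ((i - length A) + (length A - i))" if "i < length p" for i
    proof (cases "length A \<le> i")
      case True
      then have "(c # B) ! (i - length A) = p ! i"
        using p by (simp add: nth_append)
      then have "(q1 @ c # B) ! (length q1 + (i - length A)) = p ! i"
        by (simp only: nth_append_length_plus)
      then show ?thesis
        using gdist_hd_nth[OF up, of "length q1 + (i - length A)"] True that p v by simp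
    next
      case False
      then have "(c # rev A) ! (length A - i) = p ! i"
        using p by (auto simp: nth_append rev_nth nth_Cons' Suc_diff_Suc)
      then have "(q1 @ c # rev A) ! (length q1 + (length A - i)) = p ! i"
        by (simp only: nth_append_length_plus)
      then show ?thesis
        using gdist_hd_nth[OF down, of "length q1 + (length A - i)"] False v by simp
    qed
  qed (simp add: p)
qed

section \<open>Eccentricities on and off a path\<close>

lemma gdist_le_ecc:
  assumes "finite (verts G)" "w \<in> verts G"
  shows "gdist G v w \<le> ecc G v"
  using assms by (auto simp: ecc_def)

lemma ecc_le:
  assumes "finite (verts G)" "verts G \<noteq> {}" "\<And>w. w \<in> verts G \<Longrightarrow> gdist G v w \<le> b"
  shows "ecc G v \<le> b"
  using assms by (auto simp: ecc_def)

lemma (in simple_tree) ecc_attained: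
  assumes "v \<in> verts T"
  obtains p where "vpath p T" "hd p = v" "length p = Suc (ecc T v)"
proof -
  have "ecc T v \<in> gdist T v ` verts T"
    unfolding ecc_def using assms by (intro Max_in) auto
  then obtain w where w: "w \<in> verts T" "ecc T v = gdist T v w" by auto
  obtain p where p: "vpath p T" "hd p = v" "last p = w"
    using vpath_exists[OF assms w(1)] .
  then have "length p = Suc (ecc T v)"
    using gdist_vpath[OF p(1)] w p by (cases p) (auto simp: vpath_iff_successively)
  with p that show ?thesis by blast
qed

lemma (in simple_tree) gdist_self: "v \<in> verts T \<Longrightarrow> gdist T v v = 0"
  using gdist_vpath[of "[v]"] by (simp add: vpath_iff_successively)

text \<open>The attachment lemma at \<open>v = p ! i\<close>: distance 0 from \<open>p ! i\<close>
  to itself forces a branch of length 0 attached at index \<open>i\<close>.\<close>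

lemma (in simple_tree) gdist_nth_nth:
  assumes "vpath p T" "i < length p" "j < length p"
  shows "gdist T (p ! i) (p ! j) = (j - i) + (i - j)"
proof -
  have v: "p ! i \<in> verts T" using assms by (simp_all add: vpath_nth_in_verts)
  obtain k h where a: "k < length p" "h = 0 \<longleftrightarrow> p ! i \<in> set p"
    "h = 1 \<Longrightarrow> p ! i \<rightarrow>\<^bsub>T\<^esub> p ! k"
    "\<And>j. j < length p \<Longrightarrow> gdist T (p ! i) (p ! j) = h + ((j - k) + (k - j))"
    by (rule gdist_to_vpath[OF assms(1) v]) (rule that)
  have "h + ((i - k) + (k - i)) = 0" using a(4)[OF assms(2)] gdist_self[OF v] by simp
  then have "h = 0" "k = i" by auto
  with a(4)[OF assms(3)] show ?thesis by simp
qed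

lemma (in simple_tree) gdist_commute:
  assumes "u \<in> verts T" "v \<in> verts T"
  shows "gdist T u v = gdist T v u"
proof -
  obtain p where p: "vpath p T" "hd p = u" "last p = v"
    using vpath_exists[OF assms] .
  then have "vpath (rev p) T" by (simp add: vpath_iff_successively dominates_commute)
  from gdist_vpath[OF this] gdist_vpath[OF p(1)] p show ?thesis
    by (simp add: hd_rev last_rev)
qed

lemma (in simple_tree) ecc_on_vpath_ge:
  assumes "vpath p T" "length p = Suc e" "j \<le> e"
  shows "max j (e - j) \<le> ecc T (p ! j)"
proof -
  have "p ! 0 \<in> verts T" "p ! e \<in> verts T"
    using assms by (simp_all add: vpath_nth_in_verts)
  from this[THEN gdist_le_ecc[OF finite_verts], of "p ! j"] show ?thesis
    using gdist_nth_nth[OF assms(1), of j 0] gdist_nth_nth[OF assms(1), of j e] assms by simp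
qed

text \<open>The distances to the ends of \<open>p\<close> are \<open>h + j\<close> and
  \<open>h + (e - j)\<close> with \<open>h \<ge> 1\<close>, so they add up to at least
  \<open>e + 2\<close> and the larger is at least half of that, rounded up. For even
  \<open>e\<close>, equality leaves only \<open>h = 1\<close> and
  \<open>j = e div 2\<close>.\<close>

lemma (in simple_tree) ecc_off_vpath_ge:
  assumes "vpath p T" "length p = Suc e" "v \<in> verts T - set p"
  shows "(e + 1) div 2 + 1 \<le> ecc T v"
    and "even e \<Longrightarrow> ecc T v = e div 2 + 1 \<Longrightarrow> v \<rightarrow>\<^bsub>T\<^esub> p ! (e div 2)"
proof -
  have v: "v \<in> verts T" using assms by auto
  obtain j h where a: "j < length p" "h = 0 \<longleftrightarrow> v \<in> set p"
    "h = 1 \<Longrightarrow> v \<rightarrow>\<^bsub>T\<^esub> p ! j"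
    "\<And>i. i < length p \<Longrightarrow> gdist T v (p ! i) = h + ((i - j) + (j - i))"
    by (rule gdist_to_vpath[OF assms(1) v]) (rule that)
  have "p ! 0 \<in> verts T" "p ! e \<in> verts T"
    using assms by (simp_all add: vpath_nth_in_verts)
  from this[THEN gdist_le_ecc[OF finite_verts], of v]
  have le: "h + j \<le> ecc T v" "h + (e - j) \<le> ecc T v"
    using a(4)[of 0] a(4)[of e] a(1) assms(2) by simp_all
  have h: "1 \<le> h" using a(2) assms(3) by auto
  show "(e + 1) div 2 + 1 \<le> ecc T v"
    using le h by linarith
  assume e: "even e" "ecc T v = e div 2 + 1"
  then have "h = 1" "j = e div 2"
    using le h by (auto elim!: evenE)
  then show "v \<rightarrow>\<^bsub>T\<^esub> p ! (e div 2)" using a(3) by simp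
qed

text \<open>With every branch vertex at the middle \<open>p ! x\<close>, distances to \<open>p ! i\<close> are
  \<open>1 + \<bar>i - x\<bar>\<close>, and two branch vertices are at distance at most 2.\<close>

lemma (in simple_tree) ecc_spider_le:
  assumes p: "vpath p T" "length p = Suc (2 * x)" and x: "1 \<le> x"
    and off: "\<And>v. v \<in> verts T - set p \<Longrightarrow> v \<rightarrow>\<^bsub>T\<^esub> p ! x"
  shows "j \<le> 2 * x \<Longrightarrow> ecc T (p ! j) \<le> max j (2 * x - j)"
    and "v \<in> verts T - set p \<Longrightarrow> ecc T v \<le> x + 1"
proof -
  have cx: "p ! x \<in> verts T" using p by (simp add: vpath_nth_in_verts)
  then have ne: "verts T \<noteq> {}" by blast
  have on_on: "gdist T (p ! j) (p ! i) \<le> max j (2 * x - j)" if "i \<le> 2 * x" "j \<le> 2 * x" for i j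
    using gdist_nth_nth[OF p(1), of j i] that p(2) by simp
  have off_on: "gdist T v (p ! i) = 1 + ((i - x) + (x - i))"
    if "v \<in> verts T - set p" "i \<le> 2 * x" for v i
  proof -
    have v: "v \<in> verts T" using that by simp
    obtain j h where a: "j < length p" "h = 0 \<longleftrightarrow> v \<in> set p"
      "h = 1 \<Longrightarrow> v \<rightarrow>\<^bsub>T\<^esub> p ! j"
      "\<And>i. i < length p \<Longrightarrow> gdist T v (p ! i) = h + ((i - j) + (j - i))"
      by (rule gdist_to_vpath[OF p(1) v]) (rule that)
    have "vwalk [v, p ! x] T"
      using off[OF that(1)] v cx by (simp add: vwalk_iff_successively)
    from gdist_le_vwalk[OF this] have "gdist T v (p ! x) \<le> 1" by simp
    \<comment> \<open>Adjacency to \<open>p ! x\<close> leaves room only for a branch of length 1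
      attached exactly at \<open>x\<close>.\<close>
    then have "h + ((x - j) + (j - x)) \<le> 1" using a(4)[of x] p(2) by simp
    moreover have "h \<noteq> 0" using a(2) that by simp
    ultimately have "h = 1" "j = x" by auto
    then show ?thesis using a(4)[of i] that p(2) by simp
  qed
  have on_off: "gdist T (p ! i) v = 1 + ((i - x) + (x - i))"
    if "v \<in> verts T - set p" "i \<le> 2 * x" for v i
  proof -
    have "p ! i \<in> verts T" using p that by (simp add: vpath_nth_in_verts)
    then show ?thesis using off_on[OF that] gdist_commute that by simp
  qed
  have off_off: "gdist T v w \<le> 2" if "v \<in> verts T - set p" "w \<in> verts T - set p" for v w
  proof -
    have "vwalk [v, p ! x, w] T"
      using off[OF that(1)] off[OF that(2)] that cx by (auto simp: vwalk_iff_successively dominates_commute)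
    from gdist_le_vwalk[OF this] show ?thesis by simp
  qed
  have on: "w \<in> set p \<Longrightarrow> \<exists>i\<le>2 * x. w = p ! i" for w
    using p by (auto simp: in_set_conv_nth less_Suc_eq_le)
  show "ecc T (p ! j) \<le> max j (2 * x - j)" if "j \<le> 2 * x"
  proof (intro ecc_le ne finite_verts)
    fix w assume w: "w \<in> verts T"
    show "gdist T (p ! j) w \<le> max j (2 * x - j)"
    proof (cases "w \<in> set p")
      case True
      then show ?thesis using on on_on that by blast
    next
      case False
      \<comment> \<open>Here \<open>max j (2 * x - j)\<close> equals
        \<open>x + \<bar>j - x\<bar>\<close>, which dominates the distance because
        \<open>1 \<le> x\<close>.\<close>
      then show ?thesis using on_off[of w j] that w x by auto
    qed
  qed
  show "ecc T v \<le> x + 1" if v: "v \<in> verts T - set p"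
  proof (intro ecc_le ne finite_verts)
    fix w assume w: "w \<in> verts T"
    show "gdist T v w \<le> x + 1"
    proof (cases "w \<in> set p")
      case True
      then obtain i where "i \<le> 2 * x" "w = p ! i" using on by blast
      then show ?thesis using off_on[OF v, of i] by auto
    next
      case False
      then show ?thesis using off_off[of v w] v w x by auto
    qed
  qed
qed

section \<open>The sum over the path and an inequality for odd eccentricity\<close>

text \<open>Induction in steps of 2: deleting the two end terms, both \<open>e + 2\<close>, leaves
  the sum for \<open>e\<close> with each of its \<open>e + 1\<close> terms raised by 1. The factor 4
  and \<open>e mod 2\<close> treat both parities at once.\<close>

lemma sum_max_path: "4 * (\<Sum>j\<le>e. max j (e - j)) = 3 * e\<^sup>2 + 4 * e + e mod (2::nat)"
proof (induct e rule: nat_induct2)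
  case (step e)
  have "(\<Sum>j\<le>e + 2. max j (e + 2 - j)) =
      (e + 2) + ((\<Sum>j\<le>e. max (Suc j) (e + 2 - Suc j)) + (e + 2))"
    by (subst add_2_eq_Suc', subst sum.atMost_Suc_shift, subst sum.atMost_Suc) simp
  also have "(\<Sum>j\<le>e. max (Suc j) (e + 2 - Suc j)) = (\<Sum>j\<le>e. Suc (max j (e - j)))"
    by (intro sum.cong) auto
  also have "\<dots> = (\<Sum>j\<le>e. max j (e - j)) + Suc e"
    by (simp add: sum_Suc)
  finally show ?case
    using step by (simp add: power2_eq_square algebra_simps)
qed auto

text \<open>The difference of the two sides is affine in \<open>m\<close>, so for \<open>y \<ge> 3\<close> its values at
  \<open>m = y\<^sup>2 - y + 1\<close> and \<open>m = y\<^sup>2 + y\<close> decide; they are computed with \<open>x = y + t\<close>.\<close>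

lemma odd_ecc_inequality:
  fixes x y m :: int
  assumes "y * (y - 1) < m" "m \<le> y * (y + 1)" "4 \<le> m" "2 * x + 1 \<le> m" "1 \<le> y"
  shows "(2 * x + 1) * (y\<^sup>2 + m) < y * (2 * x\<^sup>2 + 3 * m)"
proof -
  have "y \<noteq> 1" using assms by auto
  then consider "y = 2" | "3 \<le> y" using assms by linarith
  then show ?thesis
  proof cases
    \<comment> \<open>For \<open>y = 2\<close> and \<open>x = y\<close> the value \<open>?l\<close>
      used below would be -1, so the three possible \<open>m\<close> are settled by completing
      squares.\<close>
    case 1
    then consider "m = 4" | "m = 5" | "m = 6" using assms by fastforce
    then show ?thesis
    proof cases
      case 1
      \<comment> \<open>At \<open>x = 2\<close> the two sides would be equal;
        \<open>2 * x + 1 \<le> m\<close> rules this out.\<close>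
      then have "0 < (2 - x) * (2 - x)" using assms by (intro mult_pos_pos) auto
      with 1 \<open>y = 2\<close> show ?thesis by (simp add: power2_eq_square algebra_simps)
    next
      case 2
      have "0 \<le> (4 * x - 9) * (4 * x - 9)" by simp
      with 2 \<open>y = 2\<close> show ?thesis by (simp add: power2_eq_square algebra_simps)
    next
      case 3
      have "0 \<le> (2 * x - 5) * (2 * x - 5)" by simp
      with 3 \<open>y = 2\<close> show ?thesis by (simp add: power2_eq_square algebra_simps)
    qed
  next
    case 2
    define t where "t = x - y"
    have x: "x = y + t" by (simp add: t_def)
    have t1: "0 \<le> t * (t - 1)"
      by (cases "t \<le> 0") (auto intro: mult_nonpos_nonpos mult_nonneg_nonneg)
    have t2: "0 \<le> t * (y * t + y - 1)"
    proof (cases "0 \<le> t")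
      case True
      moreover have "0 \<le> y * t" using True 2 by (intro mult_nonneg_nonneg) auto
      ultimately have "0 \<le> y * t + y - 1" using 2 by linarith
      then show ?thesis using True by (intro mult_nonneg_nonneg)
    next
      case False
      then have "y * (t + 1) \<le> 0" using 2 by (intro mult_nonneg_nonpos) auto
      then show ?thesis using False by (intro mult_nonpos_nonpos) (auto simp: algebra_simps)
    qed
    have y1: "0 < (y - 2) * (y + 1)" using 2 by (intro mult_pos_pos) auto
    have "2 * 1 \<le> (y - 1) * (y - 2)" using 2 by (intro mult_mono) auto
    then have "3 * 2 \<le> y * ((y - 1) * (y - 2))" using 2 by (intro mult_mono) auto
    then have l: "0 < 2 * (t * (y * t + y - 1)) + y * ((y - 1) * (y - 2)) - 1" (is "0 < ?l")
      using t2 by linarith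
    have r: "0 < y * (2 * (t * (t - 1)) + (y - 2) * (y + 1) + 1)" (is "0 < ?r")
      using t1 y1 2 by (intro mult_pos_pos) auto
    have m: "0 \<le> y * (y + 1) - m" "0 \<le> m - (y * (y - 1) + 1)" using assms by auto
    \<comment> \<open>Linear interpolation in \<open>m\<close>: \<open>?l\<close> and
      \<open>?r\<close> are the differences at the lower and upper end of its range, and
      \<open>2 * y - 1\<close> is the distance of these ends.\<close>
    have "0 < (y * (y + 1) - m) * ?l + (m - (y * (y - 1) + 1)) * ?r"
    proof (cases "m = y * (y + 1)")
      case True
      then have "0 < m - (y * (y - 1) + 1)" using 2 by (simp add: algebra_simps)
      then have "0 < (m - (y * (y - 1) + 1)) * ?r" using r by (rule mult_pos_pos)
      with True show ?thesis by simp
    next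
      case False
      then have "0 < (y * (y + 1) - m) * ?l" using l m by (intro mult_pos_pos) auto
      moreover have "0 \<le> (m - (y * (y - 1) + 1)) * ?r"
        using m(2) by (intro mult_nonneg_nonneg less_imp_le[OF r])
      ultimately show ?thesis by linarith
    qed
    also have "\<dots> = (2 * y - 1) * (y * (2 * x\<^sup>2 + 3 * m) - (2 * x + 1) * (y\<^sup>2 + m))"
      unfolding x by (simp add: power2_eq_square algebra_simps)
    finally show ?thesis using 2 by (simp add: zero_less_mult_iff)
  qed
qed

section \<open>Lower bound for the total eccentricity and its equality case\<close>

lemma (in simple_tree) total_ecc_split:
  assumes p: "vpath p T" "length p = Suc e"
  shows "total_ecc T = (\<Sum>j\<le>e. ecc T (p ! j)) + (\<Sum>v\<in>verts T - set p. ecc T v)"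
proof -
  have "bij_betw ((!) p) {..e} (set p)"
    using p by (intro bij_betw_nth) (auto simp: vpath_iff_successively)
  then have "(\<Sum>j\<le>e. ecc T (p ! j)) = (\<Sum>v\<in>set p. ecc T v)"
    by (rule sum.reindex_bij_betw)
  then show ?thesis
    using p sum.subset_diff[of "set p" "verts T" "ecc T"]
    by (auto simp: total_ecc_def vpath_iff_successively)
qed

lemma (in simple_tree) card_off_vpath:
  assumes "vpath p T" "length p = Suc e"
  shows "Suc e \<le> card (verts T)" "card (verts T - set p) = card (verts T) - Suc e"
proof -
  have sub: "set p \<subseteq> verts T" and c: "card (set p) = Suc e"
    using assms by (auto simp: vpath_iff_successively distinct_card)
  show "Suc e \<le> card (verts T)" using card_mono[OF _ sub] c by simp
  show "card (verts T - set p) = card (verts T) - Suc e"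
    using card_Diff_subset[OF _ sub] c by simp
qed

lemma (in simple_tree) total_ecc_ge:
  assumes p: "vpath p T" "length p = Suc e"
  shows "(\<Sum>j\<le>e. max j (e - j)) + (card (verts T) - Suc e) * ((e + 1) div 2 + 1) \<le> total_ecc T"
proof -
  have "(\<Sum>j\<le>e. max j (e - j)) \<le> (\<Sum>j\<le>e. ecc T (p ! j))"
    using ecc_on_vpath_ge[OF p] by (intro sum_mono) simp
  moreover have "card (verts T - set p) * ((e + 1) div 2 + 1) \<le> (\<Sum>v\<in>verts T - set p. ecc T v)"
    using sum_bounded_below[of "verts T - set p" "(e + 1) div 2 + 1" "ecc T"]
      ecc_off_vpath_ge(1)[OF p] by simp
  ultimately show ?thesis
    unfolding total_ecc_split[OF p] card_off_vpath(2)[OF p, symmetric] by (rule add_mono)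
qed

text \<open>Equality of the sums forces equality in the bound for each vertex off \<open>p\<close>,
  hence adjacency to the middle. Conversely, the upper bounds for such a spider coincide with the
  lower ones.\<close>

lemma (in simple_tree) total_ecc_eq_iff:
  assumes p: "vpath p T" "length p = Suc (2 * x)" and x: "1 \<le> x"
  shows "total_ecc T = (\<Sum>j\<le>2 * x. max j (2 * x - j)) + (card (verts T) - Suc (2 * x)) * (x + 1) \<longleftrightarrow>
    (\<forall>v\<in>verts T - set p. v \<rightarrow>\<^bsub>T\<^esub> p ! x)" (is "total_ecc T = ?A + ?B \<longleftrightarrow> _")
proof -
  let ?O = "verts T - set p"
  have on: "?A \<le> (\<Sum>j\<le>2 * x. ecc T (p ! j))"
    using ecc_on_vpath_ge[OF p] by (intro sum_mono) simp
  have B: "?B = (\<Sum>v\<in>?O. x + 1)"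
    using card_off_vpath(2)[OF p] by simp
  have ge: "x + 1 \<le> ecc T v" if "v \<in> ?O" for v
    using ecc_off_vpath_ge(1)[OF p that] by simp
  show ?thesis
  proof
    assume "total_ecc T = ?A + ?B"
    then have "(\<Sum>v\<in>?O. ecc T v) \<le> (\<Sum>v\<in>?O. x + 1)"
      using on unfolding total_ecc_split[OF p] B by linarith
    moreover have "(\<Sum>v\<in>?O. x + 1) \<le> (\<Sum>v\<in>?O. ecc T v)"
      using ge by (rule sum_mono)
    ultimately have eq: "(\<Sum>v\<in>?O. x + 1) = (\<Sum>v\<in>?O. ecc T v)"
      by (rule antisym[rotated])
    show "\<forall>v\<in>?O. v \<rightarrow>\<^bsub>T\<^esub> p ! x"
    proof
      fix v assume v: "v \<in> ?O"
      have "x + 1 = ecc T v"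
        using sum_mono_inv[OF eq ge v] by simp
      then show "v \<rightarrow>\<^bsub>T\<^esub> p ! x"
        using ecc_off_vpath_ge(2)[OF p v] by simp
    qed
  next
    assume off: "\<forall>v\<in>?O. v \<rightarrow>\<^bsub>T\<^esub> p ! x"
    have "(\<Sum>j\<le>2 * x. ecc T (p ! j)) \<le> ?A"
      using ecc_spider_le(1)[OF p x] off by (intro sum_mono) simp
    moreover have "(\<Sum>v\<in>?O. ecc T v) \<le> (\<Sum>v\<in>?O. x + 1)"
      using ecc_spider_le(2)[OF p x] off by (intro sum_mono) simp
    ultimately have "total_ecc T \<le> ?A + ?B"
      unfolding total_ecc_split[OF p] B by (rule add_mono)
    moreover have "?A + ?B \<le> total_ecc T"
      using total_ecc_ge[OF p] by simp
    ultimately show "total_ecc T = ?A + ?B" by (rule antisym)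
  qed
qed

text \<open>All eccentricities are at most \<open>2 * x\<close>, and the length of any path is the
  distance of its ends.\<close>

lemma (in simple_tree) longest_path_spider:
  assumes p: "vpath p T" "length p = Suc (2 * x)" and x: "1 \<le> x"
    and off: "\<And>v. v \<in> verts T - set p \<Longrightarrow> v \<rightarrow>\<^bsub>T\<^esub> p ! x"
  shows "longest_path p T"
proof -
  have le: "ecc T v \<le> 2 * x" if "v \<in> verts T" for v
  proof (cases "v \<in> set p")
    case True
    then obtain j where "j \<le> 2 * x" "v = p ! j"
      using p(2) by (auto simp: in_set_conv_nth less_Suc_eq_le)
    then show ?thesis using ecc_spider_le(1)[OF p x off, of j] by auto
  next
    case False
    then show ?thesis using ecc_spider_le(2)[OF p x off, of v] that x by auto
  qed
  have "length q - 1 \<le> 2 * x" if q: "vpath q T" for q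
  proof -
    have "hd q \<in> verts T" "last q \<in> verts T"
      using q by (auto simp: vpath_iff_successively)
    then show ?thesis
      using gdist_vpath[OF q] gdist_le_ecc[OF finite_verts, of "last q" "hd q"] le[of "hd q"]
      by linarith
  qed
  then show ?thesis using p by (simp add: longest_path_def)
qed

text \<open>Reduces the structural condition to two numerical ones. For the converse, a path from
  \<open>u\<close> to a farthest vertex serves as the longest path.\<close>

lemma (in simple_tree) extremal_at_iff:
  assumes u: "u \<in> verts T" and x: "1 \<le> x"
  shows "extremal_at T u (2 * x) \<longleftrightarrow> ecc T u = 2 * x \<and>
    total_ecc T = (\<Sum>j\<le>2 * x. max j (2 * x - j)) + (card (verts T) - Suc (2 * x)) * (x + 1)"
proof
  assume "extremal_at T u (2 * x)"
  then obtain p where p: "vpath p T" "hd p = u" "length p - 1 = 2 * x"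
      "\<forall>v\<in>verts T - set p. v \<rightarrow>\<^bsub>T\<^esub> p ! x"
    by (auto simp: extremal_at_def longest_path_def)
  then have len: "length p = Suc (2 * x)" using x by linarith
  then have "p ! 0 = u" using p(2) by (cases p) auto
  then have "ecc T u = 2 * x"
    using ecc_spider_le(1)[OF p(1) len x, of 0] ecc_on_vpath_ge[OF p(1) len, of 0] p(4) by simp
  with total_ecc_eq_iff[OF p(1) len x] p(4)
  show "ecc T u = 2 * x \<and>
    total_ecc T = (\<Sum>j\<le>2 * x. max j (2 * x - j)) + (card (verts T) - Suc (2 * x)) * (x + 1)"
    by blast
next
  assume *: "ecc T u = 2 * x \<and>
    total_ecc T = (\<Sum>j\<le>2 * x. max j (2 * x - j)) + (card (verts T) - Suc (2 * x)) * (x + 1)"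
  obtain p where p: "vpath p T" "hd p = u" "length p = Suc (ecc T u)"
    using ecc_attained[OF u] .
  then have len: "length p = Suc (2 * x)" using * by simp
  have off: "\<forall>v\<in>verts T - set p. v \<rightarrow>\<^bsub>T\<^esub> p ! x"
    using total_ecc_eq_iff[OF p(1) len x] * by blast
  then have "longest_path p T"
    using longest_path_spider[OF p(1) len x] by blast
  then show "extremal_at T u (2 * x)"
    unfolding extremal_at_def using p off len by (intro exI[of _ p] exI[of _ x]) simp
qed

text \<open>Keeps the denominator of the ratio nonzero.\<close>

lemma (in simple_tree) ecc_pos:
  assumes "u \<in> verts T" "2 \<le> card (verts T)"
  shows "0 < ecc T u"
proof (rule ccontr)
  assume *: "\<not> 0 < ecc T u"
  obtain p where p: "vpath p T" "hd p = u" "length p = Suc (ecc T u)"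
    using ecc_attained[OF assms(1)] .
  have "card (verts T - set p) \<noteq> 0"
    using card_off_vpath(2)[OF p(1,3)] * assms(2) by simp
  then obtain v where v: "v \<in> verts T - set p" by (metis card_eq_0_iff ex_in_conv)
  obtain q where q: "vpath q T" "hd q = u" "last q = v"
    using vpath_exists[OF assms(1)] v by blast
  have "length q - 1 = 0"
    using gdist_vpath[OF q(1)] gdist_le_ecc[OF finite_verts, of v u] q(2,3) v * by simp
  then have "u = v"
    using q by (cases q) auto
  moreover have "u \<in> set p" using p(2,3) by (cases p) auto
  ultimately show False using v by simp
qed

section \<open>Minimization over the half-length and the form of the bound\<close>

text \<open>Divided by \<open>x * y\<close>, the product is
  \<open>(x + m / x) - (y + m / y)\<close>. So \<open>y\<close> minimizes \<open>x + m / x\<close>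
  over the positive integers, and a tie occurs only at \<open>y + 1\<close>.\<close>

lemma product_gap:
  fixes x y m :: int
  assumes "y * (y - 1) < m" "m \<le> y * (y + 1)" "1 \<le> y" "1 \<le> x"
  shows "0 \<le> (x - y) * (x * y - m)"
    and "(x - y) * (x * y - m) = 0 \<longleftrightarrow> x = y \<or> x = y + 1 \<and> m = y * (y + 1)"
proof -
  consider "x = y" | "x = y + 1" | "y + 2 \<le> x" | "x \<le> y - 1" by linarith
  then have "0 \<le> (x - y) * (x * y - m) \<and>
    ((x - y) * (x * y - m) = 0 \<longleftrightarrow> x = y \<or> x = y + 1 \<and> m = y * (y + 1))"
  proof cases
    case 3
    then have "y * (y + 2) \<le> y * x" using assms by (intro mult_left_mono) auto
    then have "0 < x * y - m" using assms by (simp add: algebra_simps)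
    with 3 have "0 < (x - y) * (x * y - m)" by (intro mult_pos_pos) auto
    with 3 show ?thesis by auto
  next
    case 4
    then have "y * x \<le> y * (y - 1)" using assms by (intro mult_left_mono) auto
    then have "x * y - m < 0" using assms by (simp add: algebra_simps)
    with 4 have "0 < (x - y) * (x * y - m)" by (intro mult_neg_neg) auto
    with 4 show ?thesis by auto
  qed (use assms in \<open>auto simp: algebra_simps\<close>)
  then show "0 \<le> (x - y) * (x * y - m)"
    and "(x - y) * (x * y - m) = 0 \<longleftrightarrow> x = y \<or> x = y + 1 \<and> m = y * (y + 1)" by auto
qed

text \<open>Both cases of the bound have the form \<open>m / 2 + (y + m / y) / 2\<close> with \<open>m = n - 1\<close>, where \<open>y\<close>
  is a positive integer minimizing \<open>y + m / y\<close>.\<close>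

lemma ecc_ratio_bound_eq:
  assumes n: "5 \<le> n" and i: "i \<le> 2 * k" and nk: "4 * n - 4 = k\<^sup>2 + i"
  obtains y :: nat where "1 \<le> y" "(if even k then k else k + 1) = 2 * y"
    "int y * (int y - 1) < int n - 1" "int n - 1 \<le> int y * (int y + 1)"
    "int n - 1 = int y * (int y + 1) \<longleftrightarrow> even k \<and> i = 2 * k"
    "ecc_ratio_bound n k i = (real n - 1) / 2 + (real y + (real n - 1) / real y) / 2"
proof -
  define m where "m = int n - 1"
  have "int (4 * n - 4) = int (k\<^sup>2 + i)" using nk by simp
  then have m: "4 * m = int k * int k + int i"
    using n by (simp add: m_def of_nat_diff power2_eq_square)
  have rm: "real n - 1 = of_int m" by (simp add: m_def)
  have "real_of_int (4 * m) = of_int (int k * int k + int i)" using m by (simp only:)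
  then have ri: "real i = 4 * of_int m - real k * real k" by simp
  have k0: "k \<noteq> 0"
    using n i nk by (cases k) auto
  show ?thesis
  proof (cases "even k")
    case True
    then obtain y where k: "k = 2 * y" by (elim evenE)
    with k0 have y: "1 \<le> y" by simp
    have m': "4 * m = 4 * (int y * int y) + int i" using m k by simp
    show ?thesis
    proof (rule that[OF y], unfold m_def[symmetric])
      show "int y * (int y - 1) < m" "m \<le> int y * (int y + 1)"
        using m' i k y by (auto simp: algebra_simps)
      show "m = int y * (int y + 1) \<longleftrightarrow> even k \<and> i = 2 * k"
        using m' k by (auto simp: algebra_simps)
      show "ecc_ratio_bound n k i = (real n - 1) / 2 + (real y + (real n - 1) / real y) / 2"
        unfolding ecc_ratio_bound_def ri rm using k y by (simp add: field_simps)
    qed (use k in simp)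
  next
    case False
    then obtain y' where "k = 2 * y' + 1" by (elim oddE)
    \<comment> \<open>Odd \<open>k\<close> is rounded up. From \<open>k = 2 * y - 1\<close> and
      \<open>i \<le> 4 * y - 2\<close> it follows that \<open>y * (y - 1) < m < y * y\<close>, so no
      tie arises here.\<close>
    then obtain y where k: "k + 1 = 2 * y" and y: "1 \<le> y" by (intro that[of "y' + 1"]) auto
    then have ky: "int k = 2 * int y - 1" "real k = 2 * real y - 1" by linarith+
    have m': "4 * m = 4 * (int y * int y) - 4 * int y + 1 + int i"
      using m unfolding ky by (simp add: algebra_simps)
    have i': "int i \<le> 4 * int y - 2" using i ky by linarith
    show ?thesis
    proof (rule that[OF y], unfold m_def[symmetric])
      show "int y * (int y - 1) < m" "m \<le> int y * (int y + 1)"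
        using m' i' y by (auto simp: algebra_simps)
      show "m = int y * (int y + 1) \<longleftrightarrow> even k \<and> i = 2 * k"
        using m' i' False by (auto simp: algebra_simps)
      show "ecc_ratio_bound n k i = (real n - 1) / 2 + (real y + (real n - 1) / real y) / 2"
        unfolding ecc_ratio_bound_def ri rm ky using False y by (simp add: field_simps)
    qed (use k False in simp)
  qed
qed

theorem theorem2p4:
  fixes T :: "('a, 'b) pre_digraph" and u :: 'a and n k i :: nat
  assumes "simple_tree T"
    and "card (verts T) = n"
    and "n \<ge> 5"
    and "i \<le> 2 * k"
    and "4 * n - 4 = k\<^sup>2 + i"
    and "leaf T u"
  shows "real (total_ecc T) / real (ecc T u) \<ge> ecc_ratio_bound n k i \<and>
    (\<not> (even k \<and> i = 2 * k) \<longrightarrow>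
      (real (total_ecc T) / real (ecc T u) = ecc_ratio_bound n k i
        \<longleftrightarrow> extremal_at T u (if even k then k else k + 1))) \<and>
    (even k \<and> i = 2 * k \<longrightarrow>
      (real (total_ecc T) / real (ecc T u) = ecc_ratio_bound n k i
        \<longleftrightarrow> extremal_at T u k \<or> extremal_at T u (k + 2)))"
proof -
  interpret simple_tree T by fact
  obtain y where y: "1 \<le> y" "(if even k then k else k + 1) = 2 * y"
    "int y * (int y - 1) < int n - 1" "int n - 1 \<le> int y * (int y + 1)"
    "int n - 1 = int y * (int y + 1) \<longleftrightarrow> even k \<and> i = 2 * k"
    "ecc_ratio_bound n k i = (real n - 1) / 2 + (real y + (real n - 1) / real y) / 2"
    by (rule ecc_ratio_bound_eq[OF assms(3-5)]) (rule that)
  have u: "u \<in> verts T" using assms(6) by (simp add: leaf_def)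
  define e where "e = ecc T u"
  have e: "0 < e" using ecc_pos[OF u] assms(2,3) by (simp add: e_def)
  obtain p where p: "vpath p T" "hd p = u" "length p = Suc e"
    using ecc_attained[OF u] unfolding e_def .
  have en: "Suc e \<le> n" using card_off_vpath(1)[OF p(1,3)] assms(2) by simp
  define L where "L = (\<Sum>j\<le>e. max j (e - j)) + (n - Suc e) * ((e + 1) div 2 + 1)"
  have L: "L \<le> total_ecc T"
    using total_ecc_ge[OF p(1,3)] assms(2) by (simp add: L_def)
  have ext: "extremal_at T u (2 * z) \<longleftrightarrow> e = 2 * z \<and> total_ecc T = L" if "1 \<le> z" for z
    using extremal_at_iff[OF u that] assms(2) by (auto simp: L_def e_def)
  let ?r = "real (total_ecc T) / real e"
  have Lr: "4 * real L = 3 * (real e)\<^sup>2 + 4 * real e + real (e mod 2) +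
      4 * (real n - 1 - real e) * (real ((e + 1) div 2) + 1)"
  proof -
    have "4 * real (\<Sum>j\<le>e. max j (e - j)) = real (4 * (\<Sum>j\<le>e. max j (e - j)))"
      by simp
    also have "\<dots> = 3 * (real e)\<^sup>2 + 4 * real e + real (e mod 2)"
      unfolding sum_max_path by simp
    finally show ?thesis
      using en unfolding L_def of_nat_add of_nat_mult by (simp add: of_nat_diff algebra_simps)
  qed
  have "ecc_ratio_bound n k i \<le> ?r \<and> (?r = ecc_ratio_bound n k i \<longleftrightarrow>
    total_ecc T = L \<and> (e = 2 * y \<or> e = 2 * (y + 1) \<and> even k \<and> i = 2 * k))"
  proof (cases "even e")
    case True
    then obtain x where x: "e = 2 * x" by (elim evenE)
    with e have x1: "1 \<le> x" by simp
    define m where "m = int n - 1"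
    have rm: "real n - 1 = of_int m" by (simp add: m_def)
    define d where "d = (int x - int y) * (int x * int y - m)"
    define s where "s = total_ecc T - L"
    have s: "real (total_ecc T) = real L + real s" using L by (simp add: s_def)
    have "real L = (real x)\<^sup>2 + of_int m * (real x + 1)"
      using Lr unfolding x rm by (simp add: power2_eq_square algebra_simps)
    \<comment> \<open>The excess over the bound has two nonnegative parts: \<open>s\<close> measures
      the deviation from a spider, \<open>d\<close> the deviation of \<open>x\<close> from a
      minimizer. Equality means that both vanish.\<close>
    then have gap: "?r - ecc_ratio_bound n k i = real s / (2 * real x) + of_int d / (2 * real x * real y)"
      unfolding s y(6) rm x d_def using x1 y(1)
      by (simp add: field_simps power2_eq_square)
    have d: "0 \<le> d" "d = 0 \<longleftrightarrow> x = y \<or> x = y + 1 \<and> even k \<and> i = 2 * k"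
      using product_gap[of "int y" m "int x"] y(1,3,4,5) x1 unfolding d_def m_def by auto
    have "0 \<le> real s / (2 * real x)" "0 \<le> of_int d / (2 * real x * real y)"
      "real s / (2 * real x) = 0 \<longleftrightarrow> total_ecc T = L" "of_int d / (2 * real x * real y) = 0 \<longleftrightarrow> d = 0"
      using x1 y(1) d(1) L by (auto simp: s_def)
    then show ?thesis using gap d(2) x by (smt (verit) mult_cancel1 zero_neq_numeral)
  next
    case False
    then obtain x where x: "e = 2 * x + 1" by (elim oddE)
    define m where "m = int n - 1"
    have rm: "real n - 1 = of_int m" by (simp add: m_def)
    \<comment> \<open>With denominators cleared, this puts \<open>L / e\<close> strictly above the
      bound, so odd \<open>e\<close> never gives equality.\<close>
    have "(2 * int x + 1) * ((int y)\<^sup>2 + m) < int y * (2 * (int x)\<^sup>2 + 3 * m)"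
      using y(1,3,4) assms(3) en x unfolding m_def by (intro odd_ecc_inequality) auto
    then have "real_of_int ((2 * int x + 1) * ((int y)\<^sup>2 + m)) < of_int (int y * (2 * (int x)\<^sup>2 + 3 * m))"
      by (simp only: of_int_less_iff)
    then have q: "(2 * real x + 1) * ((real y)\<^sup>2 + of_int m) < real y * (2 * (real x)\<^sup>2 + 3 * of_int m)"
      by simp
    have Lx: "real L = (real x)\<^sup>2 + of_int m * (real x + 2)"
      using Lr unfolding x rm by (simp add: power2_eq_square algebra_simps mod_Suc)
    have "ecc_ratio_bound n k i < real L / real e"
      unfolding Lx y(6) rm x using q y(1) by (simp add: field_simps power2_eq_square)
    also have "\<dots> \<le> ?r" using L by (simp add: divide_right_mono)
    finally show ?thesis using False by auto
  qed
  \<comment> \<open>In the tie case \<open>k = 2 * y\<close>, so the second minimizer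
    \<open>y + 1\<close> is the path length \<open>k + 2\<close>.\<close>
  then show ?thesis
    using ext[OF y(1)] ext[of "y + 1"] y(2) unfolding e_def[symmetric] by auto
qed

end
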